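(* As $n\to\infty$, $\mathrm{S}_{\mathrm{Dic}_{4n}}(2)\sim \mathrm{B}_{\mathrm{Dic}_{4n}}(2)$; that is, $\lim_{n\to\infty}\mathrm{S}_{\mathrm{Dic}_{4n}}(2)/\mathrm{B}_{\mathrm{Dic}_{4n}}(2)=1$.
   Context: For a positive integer $n$, the dicyclic group is $\mathrm{Dic}_{4n}=\langle a,b : a^{2n}=1,\ a^{n}=b^2,\ b^{-1}ab=a^{-1}\rangle$, a group of order $4n$ with elements $1,a,\dots,a^{2n-1},b,ab,\dots,a^{2n-1}b$. For a subset $A$ of a finite (multiplicatively written) group, put $A+A=\{a_1a_2: a_1,a_2\in A\}$ and $A-A=\{a_1a_2^{-1}: a_1,a_2\in A\}$. The set $A$ is MSTD if $|A+A|>|A-A|$ and balanced if $|A+A|=|A-A|$. For $k\in\mathbb{N}$, $\mathrm{S}_{\mathrm{Dic}_{4n}}(k)$ and $\mathrm{B}_{\mathrm{Dic}_{4n}}(k)$ denote the numbers of MSTD and balanced subsets of $\mathrm{Dic}_{4n}$ of cardinality $k$, respectively. *)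

theory Defs
  imports "HOL-Algebra.Algebra" "HOL-Library.Landau_Symbols"
begin

text \<open>
  The presented group \<open>\<langle>a, b : a^(2n) = 1, a^n = b^2, b^-1 a b = a^-1\<rangle>\<close>, realised on the
  normal forms \<open>a^i b^e\<close> with \<open>0 \<le> i < 2n\<close> and \<open>e\<close> in \<open>{0, 1}\<close>; the pair \<open>(i, e)\<close> stands for
  \<open>a^i b^e\<close>.  The product comes from \<open>b a^j = a^(-j) b\<close> and \<open>b^2 = a^n\<close>.  The lemmas below
  establish that, for positive \<open>n\<close>, this is a group of order \<open>4n\<close> generated by two elements
  satisfying the relations, and that it has the universal property of the presentation.
\<close>

definition Dic :: "nat \<Rightarrow> (int \<times> bool) monoid" where
  "Dic n = \<lparr>carrier = {0..<2 * int n} \<times> UNIV,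
     monoid.mult = (\<lambda>(i, e) (j, f).
       ((i + (if e then - j else j) + (if e \<and> f then int n else 0)) mod (2 * int n), e \<noteq> f)),
     one = (0, False)\<rparr>"

definition Dic_a :: "int \<times> bool" where "Dic_a = (1, False)"
definition Dic_b :: "int \<times> bool" where "Dic_b = (0, True)"

definition sumset :: "('a, 'm) monoid_scheme \<Rightarrow> 'a set \<Rightarrow> 'a set" where
  "sumset G A = A <#>\<^bsub>G\<^esub> A"

definition diffset :: "('a, 'm) monoid_scheme \<Rightarrow> 'a set \<Rightarrow> 'a set" where
  "diffset G A = A <#>\<^bsub>G\<^esub> (set_inv\<^bsub>G\<^esub> A)"

lemma sumset_eq: "sumset G A = {x \<otimes>\<^bsub>G\<^esub> y | x y. x \<in> A \<and> y \<in> A}"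
  by (auto simp: sumset_def set_mult_def)

lemma diffset_eq: "diffset G A = {x \<otimes>\<^bsub>G\<^esub> inv\<^bsub>G\<^esub> y | x y. x \<in> A \<and> y \<in> A}"
  by (auto simp: diffset_def set_mult_def SET_INV_def)

definition MSTD :: "('a, 'm) monoid_scheme \<Rightarrow> 'a set \<Rightarrow> bool" where
  "MSTD G A \<longleftrightarrow> A \<subseteq> carrier G \<and> card (sumset G A) > card (diffset G A)"

definition balanced :: "('a, 'm) monoid_scheme \<Rightarrow> 'a set \<Rightarrow> bool" where
  "balanced G A \<longleftrightarrow> A \<subseteq> carrier G \<and> card (sumset G A) = card (diffset G A)"

definition num_MSTD :: "('a, 'm) monoid_scheme \<Rightarrow> nat \<Rightarrow> nat" where
  "num_MSTD G k = card {A. MSTD G A \<and> card A = k}"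

definition num_balanced :: "('a, 'm) monoid_scheme \<Rightarrow> nat \<Rightarrow> nat" where
  "num_balanced G k = card {A. balanced G A \<and> card A = k}"

lemma carrier_Dic: "carrier (Dic n) = {0..<2 * int n} \<times> UNIV"
  by (simp add: Dic_def)

lemma one_Dic: "\<one>\<^bsub>Dic n\<^esub> = (0, False)"
  by (simp add: Dic_def)

lemma mult_Dic: "(i, e) \<otimes>\<^bsub>Dic n\<^esub> (j, f) =
    ((i + (if e then - j else j) + (if e \<and> f then int n else 0)) mod (2 * int n), e \<noteq> f)"
  by (simp add: Dic_def)

lemma order_Dic: "order (Dic n) = 4 * n"
  by (simp add: order_def carrier_Dic card_cartesian_product)

lemma group_Dic:
  assumes "n > 0"
  shows "group (Dic n)"
proof (rule groupI)
  fix x y assume "x \<in> carrier (Dic n)" "y \<in> carrier (Dic n)"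
  then show "x \<otimes>\<^bsub>Dic n\<^esub> y \<in> carrier (Dic n)"
    using assms by (cases x; cases y) (simp add: carrier_Dic mult_Dic)
next
  show "\<one>\<^bsub>Dic n\<^esub> \<in> carrier (Dic n)"
    using assms by (simp add: carrier_Dic one_Dic)
next
  fix x y z :: "int \<times> bool"
  obtain i e j f k g where [simp]: "x = (i, e)" "y = (j, f)" "z = (k, g)"
    by (cases x; cases y; cases z)
  have *: "u mod (2 * int n) = v mod (2 * int n)"
    if "u = v \<or> u = v + 2 * int n \<or> v = u + 2 * int n" for u v
    using that by auto
  have l: "(u mod m + s + t) mod m = (u + s + t) mod m" for u s t m :: int
    by (metis mod_add_left_eq)
  have r: "(u + v mod m + t) mod m = (u + v + t) mod m" for u v t m :: int
    by (metis mod_add_left_eq mod_add_right_eq)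
  have r': "(u + - (v mod m) + t) mod m = (u - v + t) mod m" for u v t m :: int
    by (metis diff_conv_add_uminus mod_add_left_eq mod_diff_right_eq)
  show "x \<otimes>\<^bsub>Dic n\<^esub> y \<otimes>\<^bsub>Dic n\<^esub> z = x \<otimes>\<^bsub>Dic n\<^esub> (y \<otimes>\<^bsub>Dic n\<^esub> z)"
    by (cases e; cases f; cases g)
      (simp_all only: \<open>x = _\<close> \<open>y = _\<close> \<open>z = _\<close> mult_Dic l r r' if_True if_False simp_thms prod.inject,
       rule *; simp)+
next
  fix x assume "x \<in> carrier (Dic n)"
  then show "\<one>\<^bsub>Dic n\<^esub> \<otimes>\<^bsub>Dic n\<^esub> x = x"
    by (cases x) (auto simp: carrier_Dic mult_Dic one_Dic)
next
  fix x assume x: "x \<in> carrier (Dic n)"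
  obtain i e where [simp]: "x = (i, e)" by (cases x)
  define y where "y = (if e then (i + int n) mod (2 * int n) else (- i) mod (2 * int n), e)"
  have "y \<in> carrier (Dic n)"
    using assms by (simp add: y_def carrier_Dic)
  moreover have "y \<otimes>\<^bsub>Dic n\<^esub> x = \<one>\<^bsub>Dic n\<^esub>"
  proof -
    have "((i + int n) mod (2 * int n) + (int n - i)) mod (2 * int n) = 0"
      unfolding mod_add_left_eq by simp
    then have "((i + int n) mod (2 * int n) - i + int n) mod (2 * int n) = 0"
      by (simp add: algebra_simps)
    moreover have "((- i) mod (2 * int n) + i) mod (2 * int n) = 0"
      by (simp add: mod_add_left_eq)
    ultimately show ?thesis
      by (simp add: y_def mult_Dic one_Dic)
  qed
  ultimately show "\<exists>y\<in>carrier (Dic n). y \<otimes>\<^bsub>Dic n\<^esub> x = \<one>\<^bsub>Dic n\<^esub>" by blast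
qed

lemma Dic_a_carrier: "n > 0 \<Longrightarrow> Dic_a \<in> carrier (Dic n)"
  and Dic_b_carrier: "n > 0 \<Longrightarrow> Dic_b \<in> carrier (Dic n)"
  by (auto simp: Dic_a_def Dic_b_def carrier_Dic)

lemma Dic_a_pow:
  "n > 0 \<Longrightarrow> Dic_a [^]\<^bsub>Dic n\<^esub> (k::nat) = (int k mod (2 * int n), False)"
proof (induction k)
  case 0
  interpret group "Dic n" using group_Dic 0 by blast
  show ?case using 0 by (simp add: one_Dic)
next
  case (Suc k)
  interpret group "Dic n" using group_Dic Suc by blast
  show ?case
    using Suc by (simp add: Dic_a_def mult_Dic mod_simps algebra_simps)
qed

lemma Dic_normal_form:
  assumes "n > 0" "k < 2 * n"
  shows "Dic_a [^]\<^bsub>Dic n\<^esub> k = (int k, False)"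
    and "Dic_a [^]\<^bsub>Dic n\<^esub> k \<otimes>\<^bsub>Dic n\<^esub> Dic_b = (int k, True)"
  using assms by (simp_all add: Dic_a_pow) (simp add: Dic_b_def mult_Dic)

lemma Dic_relations:
  assumes "n > 0"
  shows "Dic_a [^]\<^bsub>Dic n\<^esub> (2 * n) = \<one>\<^bsub>Dic n\<^esub>"
    and "Dic_a [^]\<^bsub>Dic n\<^esub> n = Dic_b [^]\<^bsub>Dic n\<^esub> (2::nat)"
    and "inv\<^bsub>Dic n\<^esub> Dic_b \<otimes>\<^bsub>Dic n\<^esub> Dic_a \<otimes>\<^bsub>Dic n\<^esub> Dic_b = inv\<^bsub>Dic n\<^esub> Dic_a"
proof -
  interpret group "Dic n" using group_Dic assms by blast
  note ab = Dic_a_carrier[OF assms] Dic_b_carrier[OF assms]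
  show "Dic_a [^]\<^bsub>Dic n\<^esub> (2 * n) = \<one>\<^bsub>Dic n\<^esub>"
    using assms by (simp add: Dic_a_pow one_Dic)
  show "Dic_a [^]\<^bsub>Dic n\<^esub> n = Dic_b [^]\<^bsub>Dic n\<^esub> (2::nat)"
    using assms ab by (simp add: Dic_a_pow numeral_2_eq_2) (simp add: Dic_b_def mult_Dic)
  have "Dic_a \<otimes>\<^bsub>Dic n\<^esub> (Dic_b \<otimes>\<^bsub>Dic n\<^esub> Dic_a) = Dic_b"
    by (simp add: Dic_a_def Dic_b_def mult_Dic mod_add_right_eq)
  then have "(Dic_a \<otimes>\<^bsub>Dic n\<^esub> Dic_b) \<otimes>\<^bsub>Dic n\<^esub> Dic_a = Dic_b"
    using ab by (simp add: m_assoc)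
  then have "inv\<^bsub>Dic n\<^esub> Dic_b \<otimes>\<^bsub>Dic n\<^esub> (Dic_a \<otimes>\<^bsub>Dic n\<^esub> Dic_b) \<otimes>\<^bsub>Dic n\<^esub> Dic_a = \<one>\<^bsub>Dic n\<^esub>"
    using ab by (simp add: m_assoc)
  then have "inv\<^bsub>Dic n\<^esub> Dic_b \<otimes>\<^bsub>Dic n\<^esub> (Dic_a \<otimes>\<^bsub>Dic n\<^esub> Dic_b) = inv\<^bsub>Dic n\<^esub> Dic_a"
    using ab by (metis inv_closed inv_equality m_closed)
  then show "inv\<^bsub>Dic n\<^esub> Dic_b \<otimes>\<^bsub>Dic n\<^esub> Dic_a \<otimes>\<^bsub>Dic n\<^esub> Dic_b = inv\<^bsub>Dic n\<^esub> Dic_a"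
    using ab by (simp add: m_assoc)
qed

lemma Dic_generated:
  assumes "n > 0"
  shows "generate (Dic n) {Dic_a, Dic_b} = carrier (Dic n)"
proof
  interpret group "Dic n" using group_Dic assms by blast
  let ?H = "generate (Dic n) {Dic_a, Dic_b}"
  show "?H \<subseteq> carrier (Dic n)"
    using assms Dic_a_carrier Dic_b_carrier by (intro generate_incl) auto
  have p: "Dic_a [^]\<^bsub>Dic n\<^esub> (k::nat) \<in> ?H" for k
    by (induction k) (auto intro: generate.intros)
  show "carrier (Dic n) \<subseteq> ?H"
  proof
    fix x assume "x \<in> carrier (Dic n)"
    then obtain k e where k: "x = (int k, e)" "k < 2 * n"
      by (auto simp: carrier_Dic) (metis zero_le_imp_eq_int)
    have "Dic_a [^]\<^bsub>Dic n\<^esub> k \<otimes>\<^bsub>Dic n\<^esub> Dic_b \<in> ?H"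
      using p by (auto intro: generate.intros)
    with p[of k] show "x \<in> ?H"
      using k Dic_normal_form[OF assms k(2)] by (cases e) auto
  qed
qed

lemma Dic_universal:
  assumes n: "n > 0" and "group H"
    and x: "x \<in> carrier H" and y: "y \<in> carrier H"
    and rel1: "x [^]\<^bsub>H\<^esub> (2 * n) = \<one>\<^bsub>H\<^esub>"
    and rel2: "x [^]\<^bsub>H\<^esub> n = y [^]\<^bsub>H\<^esub> (2::nat)"
    and rel3: "inv\<^bsub>H\<^esub> y \<otimes>\<^bsub>H\<^esub> x \<otimes>\<^bsub>H\<^esub> y = inv\<^bsub>H\<^esub> x"
  shows "\<exists>h \<in> hom (Dic n) H. h Dic_a = x \<and> h Dic_b = y"
proof -
  interpret H: group H by fact
  define h where "h = (\<lambda>(i::int, e). x [^]\<^bsub>H\<^esub> i \<otimes>\<^bsub>H\<^esub> (if e then y else \<one>\<^bsub>H\<^esub>))"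
  have per: "x [^]\<^bsub>H\<^esub> (i mod (2 * int n)) = x [^]\<^bsub>H\<^esub> i" for i :: int
  proof -
    have "x [^]\<^bsub>H\<^esub> (2 * int n) = \<one>\<^bsub>H\<^esub>"
      using rel1 by (metis int_pow_int of_nat_mult of_nat_numeral)
    then have "x [^]\<^bsub>H\<^esub> (2 * int n * (i div (2 * int n))) = \<one>\<^bsub>H\<^esub>"
      using x by (metis H.int_pow_pow H.int_pow_one)
    then have "x [^]\<^bsub>H\<^esub> (2 * int n * (i div (2 * int n)) + i mod (2 * int n))
        = x [^]\<^bsub>H\<^esub> (i mod (2 * int n))"
      unfolding H.int_pow_mult[OF x] using x by simp
    then show ?thesis by (simp only: mult_div_mod_eq)
  qed
  have xy: "x \<otimes>\<^bsub>H\<^esub> y = y \<otimes>\<^bsub>H\<^esub> inv\<^bsub>H\<^esub> x"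
    using x y rel3 by (metis H.inv_closed H.inv_solve_left H.m_assoc H.m_closed)
  have yx: "y \<otimes>\<^bsub>H\<^esub> x = inv\<^bsub>H\<^esub> x \<otimes>\<^bsub>H\<^esub> y"
    using x y xy by (metis H.inv_closed H.inv_solve_left H.inv_solve_right H.m_assoc H.m_closed)
  have nat_sw: "y \<otimes>\<^bsub>H\<^esub> x [^]\<^bsub>H\<^esub> (k::nat) = inv\<^bsub>H\<^esub> x [^]\<^bsub>H\<^esub> k \<otimes>\<^bsub>H\<^esub> y" for k
  proof (induction k)
    case (Suc k)
    have "y \<otimes>\<^bsub>H\<^esub> x [^]\<^bsub>H\<^esub> Suc k = (y \<otimes>\<^bsub>H\<^esub> x [^]\<^bsub>H\<^esub> k) \<otimes>\<^bsub>H\<^esub> x"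
      using x y by (simp add: H.m_assoc)
    also have "\<dots> = inv\<^bsub>H\<^esub> x [^]\<^bsub>H\<^esub> k \<otimes>\<^bsub>H\<^esub> (y \<otimes>\<^bsub>H\<^esub> x)"
      using x y Suc by (simp add: H.m_assoc)
    also have "\<dots> = inv\<^bsub>H\<^esub> x [^]\<^bsub>H\<^esub> Suc k \<otimes>\<^bsub>H\<^esub> y"
      using x y yx by (simp add: H.m_assoc)
    finally show ?case .
  qed (use y in simp)
  have sw: "y \<otimes>\<^bsub>H\<^esub> x [^]\<^bsub>H\<^esub> j = x [^]\<^bsub>H\<^esub> (- j) \<otimes>\<^bsub>H\<^esub> y" if j0: "0 \<le> j" for j :: int
  proof -
    obtain k where "j = int k" using j0 nonneg_int_cases by blast
    then show ?thesis
      using nat_sw[of k] x by (simp add: H.int_pow_neg int_pow_int H.nat_pow_inv)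
  qed
  have yy: "y \<otimes>\<^bsub>H\<^esub> y = x [^]\<^bsub>H\<^esub> int n"
    using rel2 y by (simp add: int_pow_int numeral_2_eq_2)
  have "h \<in> hom (Dic n) H"
  proof (rule homI)
    fix u assume "u \<in> carrier (Dic n)"
    then show "h u \<in> carrier H" using x y by (cases u) (simp add: h_def)
  next
    fix u v assume uv: "u \<in> carrier (Dic n)" "v \<in> carrier (Dic n)"
    obtain i e j f where ij: "u = (i, e)" "v = (j, f)" by (cases u; cases v)
    then have j: "0 \<le> j" using uv by (simp add: carrier_Dic)
    have pow: "x [^]\<^bsub>H\<^esub> (s + t) = x [^]\<^bsub>H\<^esub> s \<otimes>\<^bsub>H\<^esub> x [^]\<^bsub>H\<^esub> t" for s t :: int
      using x by (rule H.int_pow_mult)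
    have m: "(x [^]\<^bsub>H\<^esub> i \<otimes>\<^bsub>H\<^esub> y) \<otimes>\<^bsub>H\<^esub> (x [^]\<^bsub>H\<^esub> j \<otimes>\<^bsub>H\<^esub> z)
        = x [^]\<^bsub>H\<^esub> (i + - j) \<otimes>\<^bsub>H\<^esub> (y \<otimes>\<^bsub>H\<^esub> z)" if z: "z \<in> carrier H" for z
    proof -
      have "(x [^]\<^bsub>H\<^esub> i \<otimes>\<^bsub>H\<^esub> y) \<otimes>\<^bsub>H\<^esub> (x [^]\<^bsub>H\<^esub> j \<otimes>\<^bsub>H\<^esub> z)
          = x [^]\<^bsub>H\<^esub> i \<otimes>\<^bsub>H\<^esub> ((y \<otimes>\<^bsub>H\<^esub> x [^]\<^bsub>H\<^esub> j) \<otimes>\<^bsub>H\<^esub> z)"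
        using x y z by (simp add: H.m_assoc)
      also have "\<dots> = x [^]\<^bsub>H\<^esub> (i + - j) \<otimes>\<^bsub>H\<^esub> (y \<otimes>\<^bsub>H\<^esub> z)"
        unfolding sw[OF j] pow using x y z by (simp add: H.m_assoc)
      finally show ?thesis .
    qed
    show "h (u \<otimes>\<^bsub>Dic n\<^esub> v) = h u \<otimes>\<^bsub>H\<^esub> h v"
    proof (cases e)
      case False
      then show ?thesis using x y
        by (simp add: ij h_def mult_Dic per pow H.m_assoc del: H.r_one)
    next
      case True
      show ?thesis
      proof (cases f)
        case False
        then show ?thesis using True x y m[of "\<one>\<^bsub>H\<^esub>"]
          by (simp add: ij h_def mult_Dic per)
      next
        case True
        have "x [^]\<^bsub>H\<^esub> (i + - j + int n) = x [^]\<^bsub>H\<^esub> (i + - j) \<otimes>\<^bsub>H\<^esub> (y \<otimes>\<^bsub>H\<^esub> y)"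
          by (simp only: yy pow)
        then show ?thesis using True \<open>e\<close> x y m[OF y]
          by (simp add: ij h_def mult_Dic per)
      qed
    qed
  qed
  moreover have "h Dic_a = x" "h Dic_b = y"
    using x y by (simp_all add: h_def Dic_a_def Dic_b_def)
  ultimately show ?thesis by blast
qed

end

theory Submission imports Defs begin

text \<open>
  For two distinct elements \<open>x\<close>, \<open>y\<close> of any group, the sumset of \<open>{x, y}\<close> consists of the squares
  \<open>x\<^sup>2\<close>, \<open>y\<^sup>2\<close> and the mixed products \<open>xy\<close>, \<open>yx\<close>, and no square equals a mixed product; the
  difference set consists of \<open>1\<close>, \<open>x y\<^sup>-\<^sup>1\<close> and \<open>y x\<^sup>-\<^sup>1\<close>.  As soon as \<open>x\<^sup>2 = y\<^sup>2\<close> or \<open>xy = yx\<close>, the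
  coincidences on both sides match and \<open>{x, y}\<close> is balanced; otherwise the sumset has four
  elements and \<open>{x, y}\<close> is MSTD (\<open>MSTD_pair_iff\<close>, \<open>balanced_pair_iff\<close>).  Hence every pair is either
  MSTD or balanced, and the two counts add up to the number of pairs (\<open>num_MSTD_plus_num_balanced\<close>).

  In the dicyclic group two powers of \<open>a\<close> commute, and all elements outside \<open>\<langle>a\<rangle>\<close> have the same
  square \<open>a\<^sup>n\<close>.  So an MSTD pair has the form \<open>{a\<^sup>i, a\<^sup>j b}\<close>.  Conversely such a pair is MSTD unless
  \<open>a\<^sup>i\<close> is one of the at most four solutions of \<open>a\<^sup>2\<^sup>i \<in> {1, a\<^sup>n}\<close>.  This gives \<open>4n\<^sup>2 + O(n)\<close> MSTD pairs
  out of \<open>8n\<^sup>2 + O(n)\<close> pairs, and so as many balanced ones to leading order.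
\<close>

section \<open>Two-element subsets of an arbitrary group\<close>

lemma (in group) sumset_pair:
  "sumset G {x, y} = {x \<otimes> x, y \<otimes> y} \<union> {x \<otimes> y, y \<otimes> x}"
  by (auto simp: sumset_eq)

lemma (in group) diffset_pair:
  assumes "x \<in> carrier G" "y \<in> carrier G"
  shows "diffset G {x, y} = {\<one>, x \<otimes> inv y, y \<otimes> inv x}"
  using assms by (force simp: diffset_eq)

lemma (in group) card_sumset_pair:
  assumes "x \<in> carrier G" "y \<in> carrier G" "x \<noteq> y"
  shows "card (sumset G {x, y}) =
    (if x \<otimes> x = y \<otimes> y then 1 else 2) + (if x \<otimes> y = y \<otimes> x then 1 else 2)"
proof -
  have "{x \<otimes> x, y \<otimes> y} \<inter> {x \<otimes> y, y \<otimes> x} = {}"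
    using assms by auto
  then have "card (sumset G {x, y}) = card {x \<otimes> x, y \<otimes> y} + card {x \<otimes> y, y \<otimes> x}"
    unfolding sumset_pair by (intro card_Un_disjoint) auto
  then show ?thesis by simp
qed

lemma (in group) card_diffset_pair:
  assumes "x \<in> carrier G" "y \<in> carrier G" "x \<noteq> y"
  shows "card (diffset G {x, y}) = (if x \<otimes> inv y = y \<otimes> inv x then 2 else 3)"
proof -
  have "x \<otimes> inv y \<noteq> \<one>" "y \<otimes> inv x \<noteq> \<one>"
    using assms inv_solve_right[of \<one> x y] inv_solve_right[of \<one> y x] by auto
  then show ?thesis
    using assms by (auto simp: diffset_pair)
qed

lemma (in group) inv_mult_eq_mult_inv_iff:
  assumes x: "x \<in> carrier G" and y: "y \<in> carrier G" and z: "z \<in> carrier G" and w: "w \<in> carrier G"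
  shows "inv x \<otimes> y = z \<otimes> inv w \<longleftrightarrow> y \<otimes> w = x \<otimes> z"
proof -
  have "inv x \<otimes> y = z \<otimes> inv w \<longleftrightarrow> y = x \<otimes> (z \<otimes> inv w)"
    using x y z w inv_solve_left'[of "z \<otimes> inv w" x y] by auto
  also have "\<dots> \<longleftrightarrow> y = (x \<otimes> z) \<otimes> inv w"
    using x z w by (simp add: m_assoc)
  also have "\<dots> \<longleftrightarrow> x \<otimes> z = y \<otimes> w"
    using x y z w by (intro inv_solve_right) auto
  finally show ?thesis by auto
qed

text \<open>
  The element \<open>x\<^sup>-\<^sup>1 y\<close> mediates: it equals \<open>x y\<^sup>-\<^sup>1\<close> exactly when the squares agree, and \<open>y x\<^sup>-\<^sup>1\<close>
  exactly when \<open>x\<close> and \<open>y\<close> commute.  So once one of these holds, the difference set collapses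
  to two elements exactly when the other one holds too.
\<close>
lemma (in group) quotient_self_inverse_iff:
  assumes x: "x \<in> carrier G" and y: "y \<in> carrier G"
    and sq_or_comm: "x \<otimes> x = y \<otimes> y \<or> x \<otimes> y = y \<otimes> x"
  shows "x \<otimes> inv y = y \<otimes> inv x \<longleftrightarrow> x \<otimes> x = y \<otimes> y \<and> x \<otimes> y = y \<otimes> x"
  using sq_or_comm inv_mult_eq_mult_inv_iff[OF x y x y] inv_mult_eq_mult_inv_iff[OF x y y x] by metis

lemma (in group) card_sumset_eq_card_diffset_pair_iff:
  assumes "x \<in> carrier G" "y \<in> carrier G" "x \<noteq> y"
  shows "card (sumset G {x, y}) = card (diffset G {x, y}) \<longleftrightarrow>
    x \<otimes> x = y \<otimes> y \<or> x \<otimes> y = y \<otimes> x"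
  using assms quotient_self_inverse_iff[of x y]
  by (auto simp: card_sumset_pair card_diffset_pair)

lemma (in group) MSTD_pair_iff:
  assumes "x \<in> carrier G" "y \<in> carrier G" "x \<noteq> y"
  shows "MSTD G {x, y} \<longleftrightarrow> x \<otimes> x \<noteq> y \<otimes> y \<and> x \<otimes> y \<noteq> y \<otimes> x"
  using assms card_sumset_eq_card_diffset_pair_iff[OF assms]
  by (auto simp: MSTD_def card_sumset_pair card_diffset_pair)

lemma (in group) balanced_pair_iff:
  assumes "x \<in> carrier G" "y \<in> carrier G" "x \<noteq> y"
  shows "balanced G {x, y} \<longleftrightarrow> x \<otimes> x = y \<otimes> y \<or> x \<otimes> y = y \<otimes> x"
  using assms card_sumset_eq_card_diffset_pair_iff[OF assms] by (simp add: balanced_def)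

lemma (in group) num_MSTD_plus_num_balanced:
  assumes "finite (carrier G)"
  shows "num_MSTD G 2 + num_balanced G 2 = order G choose 2"
proof -
  let ?P = "{A. A \<subseteq> carrier G \<and> card A = 2}"
  let ?S = "{A. MSTD G A \<and> card A = 2}" and ?B = "{A. balanced G A \<and> card A = 2}"
  have "MSTD G A \<or> balanced G A" if P: "A \<in> ?P" for A
  proof -
    obtain x y where A: "A = {x, y}" "x \<noteq> y"
      using P by (auto simp: card_2_iff)
    then have "x \<in> carrier G" "y \<in> carrier G"
      using P by auto
    then show ?thesis
      using A MSTD_pair_iff[of x y] balanced_pair_iff[of x y] by blast
  qed
  then have P: "?P = ?S \<union> ?B"
    by (auto simp: MSTD_def balanced_def)
  have disj: "?S \<inter> ?B = {}"
    by (auto simp: MSTD_def balanced_def)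
  have "finite ?P"
    using assms by simp
  then have "finite ?S" "finite ?B"
    unfolding P by simp_all
  then have "num_MSTD G 2 + num_balanced G 2 = card ?P"
    unfolding num_MSTD_def num_balanced_def P by (rule card_Un_disjoint[OF _ _ disj, symmetric])
  then show ?thesis
    using n_subsets[OF assms, of 2] by (simp add: order_def)
qed

section \<open>Counting in the dicyclic group\<close>

text \<open>
  Conjugation by \<open>a\<^sup>j b\<close> inverts \<open>a\<^sup>i\<close>, so the two commute exactly when \<open>a\<^sup>2\<^sup>i = 1\<close>; and since
  \<open>(a\<^sup>j b)\<^sup>2 = a\<^sup>n\<close>, the squares agree exactly when \<open>a\<^sup>2\<^sup>i = a\<^sup>n\<close>.  Neither condition involves \<open>j\<close>.
\<close>
lemma MSTD_Dic_mixed_pair_iff: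
  assumes "n > 0" and i: "i \<in> {0..<2 * int n}" and j: "j \<in> {0..<2 * int n}"
  shows "MSTD (Dic n) {(i, False), (j, True)} \<longleftrightarrow> (2 * i) mod (2 * int n) \<notin> {0, int n}"
proof -
  interpret group "Dic n" using group_Dic assms by blast
  have "(i + j) mod (2 * int n) = (j - i) mod (2 * int n) \<longleftrightarrow> 2 * int n dvd 2 * i"
    by (simp add: mod_eq_dvd_iff)
  also have "\<dots> \<longleftrightarrow> (2 * i) mod (2 * int n) = 0"
    by (rule dvd_eq_mod_eq_0)
  finally have comm:
    "(i + j) mod (2 * int n) = (j - i) mod (2 * int n) \<longleftrightarrow> (2 * i) mod (2 * int n) = 0" .
  have "int n mod (2 * int n) = int n"
    using assms by (intro mod_pos_pos_trivial) auto
  then have sq: "(i, False) \<otimes>\<^bsub>Dic n\<^esub> (i, False) = (j, True) \<otimes>\<^bsub>Dic n\<^esub> (j, True) \<longleftrightarrow>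
      (2 * i) mod (2 * int n) = int n"
    by (simp add: mult_Dic)
  have "(i, False) \<otimes>\<^bsub>Dic n\<^esub> (j, True) = (j, True) \<otimes>\<^bsub>Dic n\<^esub> (i, False) \<longleftrightarrow>
      (2 * i) mod (2 * int n) = 0"
    by (simp only: mult_Dic comm[symmetric]) simp
  with sq show ?thesis
    using i j by (subst MSTD_pair_iff) (auto simp: carrier_Dic)
qed

lemma MSTD_Dic_pairs:
  assumes n: "n > 0"
  defines "I \<equiv> {0..<2 * int n}"
  shows "{A. MSTD (Dic n) A \<and> card A = 2} =
    (\<lambda>(i, j). {(i, False), (j, True)}) `
      ({i \<in> I. (2 * i) mod (2 * int n) \<notin> {0, int n}} \<times> I)" (is "?L = ?f ` ?R")
proof
  interpret group "Dic n" using group_Dic n by blast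
  show "?f ` ?R \<subseteq> ?L"
    using MSTD_Dic_mixed_pair_iff[OF n] by (auto simp: I_def)
  show "?L \<subseteq> ?f ` ?R"
  proof
    fix A assume "A \<in> ?L"
    then have A: "MSTD (Dic n) A" "card A = 2" by auto
    then obtain x y where xy: "A = {x, y}" "x \<noteq> y"
      by (auto simp: card_2_iff)
    obtain i e j f where ij: "x = (i, e)" "y = (j, f)"
      by (cases x; cases y)
    have c: "x \<in> carrier (Dic n)" "y \<in> carrier (Dic n)"
      using A(1) xy by (auto simp: MSTD_def)
    then have I: "i \<in> I" "j \<in> I"
      by (auto simp: ij carrier_Dic I_def)
    have "x \<otimes>\<^bsub>Dic n\<^esub> x \<noteq> y \<otimes>\<^bsub>Dic n\<^esub> y" "x \<otimes>\<^bsub>Dic n\<^esub> y \<noteq> y \<otimes>\<^bsub>Dic n\<^esub> x"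
      using A(1) MSTD_pair_iff[OF c xy(2)] xy(1) by auto
    \<comment> \<open>Two powers of \<open>a\<close> would commute; two elements outside \<open>\<langle>a\<rangle>\<close> would share the square \<open>a\<^sup>n\<close>.\<close>
    then have "e \<noteq> f"
      by (cases e) (auto simp: ij mult_Dic add.commute)
    then have "A = ?f (i, j) \<or> A = ?f (j, i)"
      using xy by (cases e) (auto simp: ij)
    then obtain k l where kl: "A = ?f (k, l)" "k \<in> I" "l \<in> I"
      using I by blast
    then have "(k, l) \<in> ?R"
      using A(1) MSTD_Dic_mixed_pair_iff[OF n, of k l] by (simp add: I_def)
    with kl(1) show "A \<in> ?f ` ?R" by blast
  qed
qed

text \<open>
  As \<open>0 \<le> 2i < 4n\<close>, the integer \<open>2i\<close> is its residue or exceeds it by \<open>2n\<close>, which leaves four values.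
\<close>
lemma card_double_mod_exceptions:
  assumes "n > 0"
  shows "card {i \<in> {0..<2 * int n}. (2 * i) mod (2 * int n) \<in> {0, int n}} \<le> 4" (is "card ?E \<le> 4")
proof -
  have "2 * i \<in> {0, int n, 2 * int n, 3 * int n}" if "i \<in> ?E" for i
  proof -
    have "(2 * i) mod (2 * int n) = (if i < int n then 2 * i else 2 * i - 2 * int n)"
    proof (cases "i < int n")
      case True
      then show ?thesis
        using that by (simp add: mod_pos_pos_trivial)
    next
      case False
      have "(2 * i) mod (2 * int n) = (2 * i - 2 * int n) mod (2 * int n)"
        by simp
      also have "\<dots> = 2 * i - 2 * int n"
        using that False by (intro mod_pos_pos_trivial) auto
      finally show ?thesis
        using False by simp
    qed
    then show ?thesis
      using that by (auto split: if_splits)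
  qed
  then have "(\<lambda>i. 2 * i) ` ?E \<subseteq> {0, int n, 2 * int n, 3 * int n}"
    by (rule image_subsetI)
  then have "card ?E \<le> card {0, int n, 2 * int n, 3 * int n}"
    by (intro card_inj_on_le[of "\<lambda>i. 2 * i"]) (simp_all add: inj_on_def)
  also have "\<dots> \<le> 4"
    by (simp add: card_insert_if)
  finally show ?thesis .
qed

lemma num_MSTD_Dic_bounds:
  assumes n: "n > 0"
  shows "4 * real n ^ 2 - 8 * real n \<le> real (num_MSTD (Dic n) 2)"
    and "real (num_MSTD (Dic n) 2) \<le> 4 * real n ^ 2"
proof -
  define I where "I = {0..<2 * int n}"
  define E where "E = {i \<in> I. (2 * i) mod (2 * int n) \<in> {0, int n}}"
  have cI: "card I = 2 * n" "finite I"
    by (simp_all add: I_def)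
  have E: "E \<subseteq> I" "card E \<le> 4"
    using card_double_mod_exceptions[OF n] by (auto simp: E_def I_def)
  have "{i \<in> I. (2 * i) mod (2 * int n) \<notin> {0, int n}} = I - E"
    by (auto simp: E_def)
  then have "num_MSTD (Dic n) 2 = card ((\<lambda>(i, j). {(i, False), (j, True)}) ` ((I - E) \<times> I))"
    using MSTD_Dic_pairs[OF n] by (simp add: num_MSTD_def I_def)
  also have "\<dots> = card ((I - E) \<times> I)"
    by (intro card_image) (auto simp: inj_on_def doubleton_eq_iff)
  also have "\<dots> = (2 * n - card E) * (2 * n)"
    using E cI by (simp add: card_cartesian_product card_Diff_subset finite_subset)
  finally have "num_MSTD (Dic n) 2 = (2 * n - card E) * (2 * n)" .
  moreover have "card E \<le> 2 * n"
    using card_mono[OF cI(2) E(1)] cI(1) by simp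
  ultimately have eq: "real (num_MSTD (Dic n) 2) = 4 * real n ^ 2 - real (card E) * (2 * real n)"
    by (simp add: of_nat_diff power2_eq_square algebra_simps)
  show "real (num_MSTD (Dic n) 2) \<le> 4 * real n ^ 2"
    unfolding eq by simp
  have "real (card E) * (2 * real n) \<le> 4 * (2 * real n)"
    using E(2) by (intro mult_right_mono) auto
  then show "4 * real n ^ 2 - 8 * real n \<le> real (num_MSTD (Dic n) 2)"
    unfolding eq by simp
qed

lemma num_balanced_Dic:
  assumes "n > 0"
  shows "real (num_balanced (Dic n) 2) = 8 * real n ^ 2 - 2 * real n - real (num_MSTD (Dic n) 2)"
proof -
  interpret group "Dic n" using group_Dic assms by blast
  have "num_MSTD (Dic n) 2 + num_balanced (Dic n) 2 = 4 * n choose 2"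
    using num_MSTD_plus_num_balanced by (simp add: carrier_Dic order_Dic)
  also have "\<dots> = 2 * n * (4 * n - 1)"
    by (simp add: choose_two)
  finally have "real (num_MSTD (Dic n) 2) + real (num_balanced (Dic n) 2) =
      real (2 * n) * real (4 * n - 1)"
    by (metis of_nat_add of_nat_mult)
  also have "real (4 * n - 1) = 4 * real n - 1"
    using assms by (simp add: of_nat_diff)
  finally show ?thesis
    by (simp add: power2_eq_square algebra_simps)
qed

lemma num_MSTD_Dic_limit:
  "(\<lambda>n. real (num_MSTD (Dic n) 2) / real n ^ 2) \<longlonglongrightarrow> 4"
proof (rule tendsto_sandwich)
  show "\<forall>\<^sub>F n in sequentially. 4 - 8 / real n \<le> real (num_MSTD (Dic n) 2) / real n ^ 2"
    using eventually_gt_at_top[of 0]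
  proof eventually_elim
    case (elim n)
    then have "4 - 8 / real n = (4 * real n ^ 2 - 8 * real n) / real n ^ 2"
      by (simp add: field_simps power2_eq_square)
    also have "\<dots> \<le> real (num_MSTD (Dic n) 2) / real n ^ 2"
      using num_MSTD_Dic_bounds(1)[OF elim] by (intro divide_right_mono) auto
    finally show ?case .
  qed
  show "\<forall>\<^sub>F n in sequentially. real (num_MSTD (Dic n) 2) / real n ^ 2 \<le> 4"
    using eventually_gt_at_top[of 0]
  proof eventually_elim
    case (elim n)
    then show ?case
      using num_MSTD_Dic_bounds(2)[OF elim] by (simp add: field_simps)
  qed
  show "(\<lambda>n. 4 - 8 / real n) \<longlonglongrightarrow> 4"
    using tendsto_diff[OF tendsto_const lim_const_over_n[of 8], of 4] by simp
qed simp

lemma num_balanced_Dic_limit: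
  "(\<lambda>n. real (num_balanced (Dic n) 2) / real n ^ 2) \<longlonglongrightarrow> 4"
proof -
  have "(\<lambda>n. 8 - 2 / real n - real (num_MSTD (Dic n) 2) / real n ^ 2) \<longlonglongrightarrow> 8 - 0 - 4"
    by (intro tendsto_diff tendsto_const lim_const_over_n num_MSTD_Dic_limit)
  moreover have "\<forall>\<^sub>F n in sequentially. 8 - 2 / real n - real (num_MSTD (Dic n) 2) / real n ^ 2 =
      real (num_balanced (Dic n) 2) / real n ^ 2"
    using eventually_gt_at_top[of 0]
  proof eventually_elim
    case (elim n)
    then show ?case
      unfolding num_balanced_Dic[OF elim] by (simp add: field_simps power2_eq_square)
  qed
  ultimately show ?thesis
    using Lim_transform_eventually by fastforce
qed

theorem mainTheorem2:
  shows "(\<lambda>n. real (num_MSTD (Dic n) 2)) \<sim>[at_top] (\<lambda>n. real (num_balanced (Dic n) 2))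
    \<and> (\<lambda>n. real (num_MSTD (Dic n) 2) / real (num_balanced (Dic n) 2)) \<longlonglongrightarrow> 1"
proof -
  have "(\<lambda>n. (real (num_MSTD (Dic n) 2) / real n ^ 2) /
      (real (num_balanced (Dic n) 2) / real n ^ 2)) \<longlonglongrightarrow> 4 / 4"
    by (intro tendsto_divide num_MSTD_Dic_limit num_balanced_Dic_limit) simp
  moreover have "\<forall>\<^sub>F n in sequentially. (real (num_MSTD (Dic n) 2) / real n ^ 2) /
      (real (num_balanced (Dic n) 2) / real n ^ 2) =
      real (num_MSTD (Dic n) 2) / real (num_balanced (Dic n) 2)"
    using eventually_gt_at_top[of 0] by eventually_elim simp
  ultimately have "(\<lambda>n. real (num_MSTD (Dic n) 2) / real (num_balanced (Dic n) 2)) \<longlonglongrightarrow> 4 / 4"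
    by (rule Lim_transform_eventually)
  then have "(\<lambda>n. real (num_MSTD (Dic n) 2) / real (num_balanced (Dic n) 2)) \<longlonglongrightarrow> 1"
    by simp
  then show ?thesis
    by (simp add: asymp_equivI')
qed

end
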